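(* Let $a,b,c>0$ be real, let $\mathcal{P}_n(x)=\mathcal{P}_n(x;a,b,c)$ for $n\in\mathbb{Z}_+$, and put $\mathcal{P}_{-2}(x)=\mathcal{P}_{-1}(x)=0$. Then for every $n\in\mathbb{Z}_+$, identically in $x$, $$\varphi_1(n)\mathcal{P}_{n-2}(x)+\varphi_2(n)\mathcal{P}_{n-1}(x)+\varphi_3(n)\mathcal{P}_n(x)+\varphi_4(n)\mathcal{P}_{n+1}(x)+\varphi_5(n)\,x\mathcal{P}_{n-1}(x)+\varphi_6(n)\,x\mathcal{P}_n(x)=0,$$ where the coefficients are as follows. For all $n\in\mathbb{Z}_+$: $$\varphi_6(n)=(2n+a+b-1)(2n+a+b)(n+1)(n+a+b-2),$$ $$\varphi_5(n)=-(2n+a+b-1)(2n+a+b)\,n\,(n+a+b-3),$$ $$\varphi_4(n)=(a+n)(c+n)(n+a+b-1)(n+a+b-2),$$ $$\varphi_1(n)=-\varphi_2(n)-\varphi_3(n)-\varphi_4(n).$$ For $n\geq 2$: $$\varphi_3(n)=-(2n+a+b-1)(n+a+b-2)\left\{n(2n+a+c-1)+(a+n)(c+n)-3n\frac{(a+n-1)(c+n-1)}{2n+a+b-3}\right\},$$ $$\begin{aligned}\varphi_2(n)=n\Bigl[&(2n+a+b-3)(2n+a+b-1)\bigl(n(2n+a+c-1)+(a+n)(c+n)\bigr)\\&-3n(2n+a+b-1)(a+n-1)(c+n-1)\\&-\tfrac12(a+n)(c+n)(2n+a+b-3)(2n+a+b-2)(n+1)\\&-(n+a+b-3)(2n+a+b-1)(2n+a+b)\frac{(a+n-2)(c+n-2)}{2n+a+b-4}\\&+\tfrac12(2n+a+b-1)(2n+a+b)(n+1)(a+n-2)(c+n-2)\Bigr].\end{aligned}$$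 For $n=0,1$: $$\varphi_2(0)=0,\qquad \varphi_3(0)=-ac(a+b-1)(a+b-2),$$ $$\varphi_2(1)=(a+b-1)(a+b+1)\bigl(a+c+1+(a+1)(c+1)\bigr)-3ac(a+b+1)-(a+1)(c+1)(a+b-1)(a+b),$$ $$\varphi_3(1)=-(a+b+1)(a+b-1)\bigl(a+c+1+(a+1)(c+1)\bigr)+3ac(a+b+1).$$
   Context: $\mathbb{Z}_+$ is the set of non-negative integers. The shifted factorial is $(u)_0=1$, $(u)_k=u(u+1)\cdots(u+k-1)$ for $k\geq 1$. For $a,b,c>0$ and $n\in\mathbb{Z}_+$, $$\mathcal{P}_n(x;a,b,c)={}_3F_2(-n,n-1+a+b,1;a,c;x)=\sum_{k=0}^{n}\frac{(-n)_k(n-1+a+b)_k(1)_k}{(a)_k(c)_k}\frac{x^k}{k!}.$$ *)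

theory Defs
  imports Complex_Main
begin

(* The series 3F2(-n, n-1+a+b, 1; a, c; x) terminates at k = n, because (-n)_k = 0 for k > n.
   The index is an integer so that the convention P_{-1} = P_{-2} = 0 can be expressed. *)
definition hypP :: "real \<Rightarrow> real \<Rightarrow> real \<Rightarrow> int \<Rightarrow> real \<Rightarrow> real" where
  "hypP a b c n x =
     (if n < 0 then 0
      else (\<Sum>k = 0..nat n.
              pochhammer (- real_of_int n) k * pochhammer (real_of_int n - 1 + a + b) k
                * pochhammer 1 k
              / (pochhammer a k * pochhammer c k) * (x ^ k / fact k)))"

definition phi6 :: "real \<Rightarrow> real \<Rightarrow> real \<Rightarrow> nat \<Rightarrow> real" where
  "phi6 a b c m = (let n = real m in
     (2*n + a + b - 1) * (2*n + a + b) * (n + 1) * (n + a + b - 2))"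

definition phi5 :: "real \<Rightarrow> real \<Rightarrow> real \<Rightarrow> nat \<Rightarrow> real" where
  "phi5 a b c m = (let n = real m in
     - ((2*n + a + b - 1) * (2*n + a + b) * n * (n + a + b - 3)))"

definition phi4 :: "real \<Rightarrow> real \<Rightarrow> real \<Rightarrow> nat \<Rightarrow> real" where
  "phi4 a b c m = (let n = real m in
     (a + n) * (c + n) * (n + a + b - 1) * (n + a + b - 2))"

(* The general formulas for phi3 and phi2 contain denominators that may vanish for m = 0, 1,
   so these two cases are listed separately. *)
definition phi3 :: "real \<Rightarrow> real \<Rightarrow> real \<Rightarrow> nat \<Rightarrow> real" where
  "phi3 a b c m =
     (if m = 0 then - (a * c * (a + b - 1) * (a + b - 2))
      else if m = 1 then
        - ((a + b + 1) * (a + b - 1) * (a + c + 1 + (a + 1) * (c + 1)))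
          + 3 * a * c * (a + b + 1)
      else (let n = real m in
        - ((2*n + a + b - 1) * (n + a + b - 2)
           * (n * (2*n + a + c - 1) + (a + n) * (c + n)
              - 3 * n * ((a + n - 1) * (c + n - 1) / (2*n + a + b - 3))))))"

definition phi2 :: "real \<Rightarrow> real \<Rightarrow> real \<Rightarrow> nat \<Rightarrow> real" where
  "phi2 a b c m =
     (if m = 0 then 0
      else if m = 1 then
        (a + b - 1) * (a + b + 1) * (a + c + 1 + (a + 1) * (c + 1))
          - 3 * a * c * (a + b + 1)
          - (a + 1) * (c + 1) * (a + b - 1) * (a + b)
      else (let n = real m in
        n * ((2*n + a + b - 3) * (2*n + a + b - 1)
               * (n * (2*n + a + c - 1) + (a + n) * (c + n))
             - 3 * n * (2*n + a + b - 1) * (a + n - 1) * (c + n - 1)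
             - 1/2 * (a + n) * (c + n) * (2*n + a + b - 3) * (2*n + a + b - 2) * (n + 1)
             - (n + a + b - 3) * (2*n + a + b - 1) * (2*n + a + b)
               * ((a + n - 2) * (c + n - 2) / (2*n + a + b - 4))
             + 1/2 * (2*n + a + b - 1) * (2*n + a + b) * (n + 1)
               * (a + n - 2) * (c + n - 2))))"

definition phi1 :: "real \<Rightarrow> real \<Rightarrow> real \<Rightarrow> nat \<Rightarrow> real" where
  "phi1 a b c m = - phi2 a b c m - phi3 a b c m - phi4 a b c m"

end

theory Submission
  imports Defs
begin

text \<open>
  Write \<open>s = a + b\<close> and let \<open>t m k\<close> be the coefficient of \<open>x ^ k\<close> in \<open>hypP a b c m\<close>. The constant
  term of the left-hand side is \<open>phi1 + phi2 + phi3 + phi4\<close>, which vanishes by the choice of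
  \<open>phi1\<close>. What remains is the coefficient of \<open>x ^ (j + 1)\<close>, in which the six numbers
  \<open>t (n - 2) (j + 1), \<dots>, t (n + 1) (j + 1), t (n - 1) j, t n j\<close> occur. They share the factor
  \<open>(-n)\<^sub>j (n - 2 + s)\<^sub>j / ((a)\<^sub>j\<^sub>+\<^sub>1 (c)\<^sub>j\<^sub>+\<^sub>1)\<close>, and after its removal they are polynomials of degree at
  most \<open>3\<close> in \<open>j\<close> (lemma \<open>shifted_hyp_coeffs\<close>).

  In the variables \<open>y = j - n\<close> and \<open>d = 2 n + s - 2\<close>, these cubics are built from the factors
  \<open>y, y + 1, y + 2\<close> of the first Pochhammer symbol and \<open>y + d, y + d + 1, y + d + 2\<close> of the second
  one. Hence at each of the points \<open>y = 0, -1, -d, -d - 1\<close> all but a few of the six terms vanish: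
  \<open>y = 0\<close> relates \<open>phi4\<close> to \<open>phi6\<close>, \<open>y = -d\<close> relates \<open>phi1\<close> to \<open>phi5\<close>, then \<open>y = -1\<close> gives \<open>phi3\<close>
  and \<open>y = -d - 1\<close> gives \<open>phi2\<close>. The values found in this way are the closed forms of lemma
  \<open>phi_closed_forms\<close>, which agree with the defining formulas, and a cubic that vanishes at four
  distinct points is zero (lemma \<open>cubic_identity\<close>); here \<open>d > 2\<close>.

  The division by \<open>n (n - 1)\<close>, \<open>d - 1\<close> and \<open>d - 2\<close> in this argument needs \<open>n \<ge> 2\<close>. For \<open>n = 0\<close> and
  \<open>n = 1\<close> all polynomials have degree at most \<open>2\<close> and the relation is checked directly.
\<close>

section \<open>The coefficients of the recurrence\<close>

text \<open>
  The quantities \<open>d\<close>, \<open>\<alpha>\<close>, \<open>\<gamma>\<close> are chosen so that \<open>2 n + a + b - 2 = d\<close>, \<open>n + a + b - 2 = d - n\<close> and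
  \<open>n + b - 2 = d - \<alpha>\<close>. The gain is that the sum defining \<open>phi1\<close> collapses to a product, and that the
  factors \<open>n\<close>, \<open>n - 1\<close>, \<open>d - n\<close> and \<open>d - n + 1\<close> become visible, which cancel against the denominators
  in \<open>shifted_hyp_coeffs\<close>.
\<close>

lemma phi_closed_forms:
  fixes a b c n d \<alpha> \<gamma> :: real
  assumes pos: "a > 0" "b > 0" and "2 \<le> m" and n: "n = real m"
    and d: "d = 2 * n + a + b - 2" and \<alpha>: "\<alpha> = a + n" and \<gamma>: "\<gamma> = c + n"
  shows "phi1 a b c m =
           - (n * (n - 1) * ((d + 1) * (d + 2) * (d - \<alpha>) * (d - \<gamma>) / ((d - 1) * (d - 2))))"
      (is ?phi1)
    and "phi2 a b c m =
           n * (d + 2) * ((d - n) * (d + 1 - \<alpha>) * (d + 1 - \<gamma>)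
             - (d + 1) * (d - n - 1) * (d - \<alpha>) * (d - \<gamma>) / (d - 2))"
      (is ?phi2)
    and "phi3 a b c m =
           (d - n) * (d + 1) * (n * (d + 2) * (\<alpha> - 1) * (\<gamma> - 1) / (d - 1) - (n + 1) * \<alpha> * \<gamma>)"
      (is ?phi3)
    and "phi4 a b c m = (d - n) * (d - n + 1) * \<alpha> * \<gamma>" (is ?phi4)
    and "phi5 a b c m = - ((d + 1) * (d + 2) * n * (d - n - 1))" (is ?phi5)
    and "phi6 a b c m = (d + 1) * (d + 2) * (n + 1) * (d - n)" (is ?phi6)
proof -
  have m: "m \<noteq> 0" "m \<noteq> 1" and "n \<ge> 2"
    using assms by auto
  then have nz: "d - 1 \<noteq> 0" "d - 2 \<noteq> 0"
    using pos d by auto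
  have subst: "b = d + 2 - 2 * n - a" "a = \<alpha> - n" "c = \<gamma> - n"
    using d \<alpha> \<gamma> by auto
  have denom: "2 * n + a + b - 3 = d - 1" "2 * n + a + b - 4 = d - 2"
    using d by auto
  show phi4: ?phi4
    unfolding phi4_def Let_def n[symmetric] subst by algebra
  show ?phi5
    unfolding phi5_def Let_def n[symmetric] subst by algebra
  show ?phi6
    unfolding phi6_def Let_def n[symmetric] subst by algebra
  show phi3: ?phi3
    unfolding phi3_def if_not_P[OF m(1)] if_not_P[OF m(2)] Let_def n[symmetric] denom
    using nz unfolding subst by (simp add: divide_simps) algebra
  show phi2: ?phi2
    unfolding phi2_def if_not_P[OF m(1)] if_not_P[OF m(2)] Let_def n[symmetric] denom
    using nz unfolding subst by (simp add: divide_simps) algebra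
  show ?phi1
    unfolding phi1_def phi2 phi3 phi4 using nz by (simp add: divide_simps) algebra
qed

text \<open>
  The left-hand side is a sum of five terms and a cubic in \<open>y\<close>. At \<open>y = 0\<close> the last two terms
  cancel and the others vanish. At \<open>y = -d\<close> only the first and the last term survive, at
  \<open>y = -d - 1\<close> also the second one, and at \<open>y = -1\<close> the last three; the fractions in the first,
  second and third term, respectively, are the values that make these sums zero.
\<close>

lemma cubic_identity:
  fixes n d y \<alpha> \<gamma> :: real
  assumes "d \<noteq> 1" "d \<noteq> 2"
  shows "- ((d + 1) * (d + 2) * (d - \<alpha>) * (d - \<gamma>) / ((d - 1) * (d - 2)))
             * (d - n - 1) * y * (y + 1) * (y + 2)
         - (d + 2) * ((d - n) * (d + 1 - \<alpha>) * (d + 1 - \<gamma>)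
               - (d + 1) * (d - n - 1) * (d - \<alpha>) * (d - \<gamma>) / (d - 2)) * (y + d) * y * (y + 1)
         + (d + 1) * (n * (d + 2) * (\<alpha> - 1) * (\<gamma> - 1) / (d - 1) - (n + 1) * \<alpha> * \<gamma>)
             * y * (y + d) * (y + d + 1)
         - (n + 1) * \<alpha> * \<gamma> * (y + d) * (y + d + 1) * (y + d + 2)
         + (d + 1) * (d + 2) * (\<alpha> + y) * (\<gamma> + y) * ((d - n - 1) * y + (n + 1) * (y + d)) = 0"
  using assms by (simp add: divide_simps) algebra

section \<open>The coefficients of the polynomials\<close>

text \<open>
  The index \<open>m\<close> is real, so that the two numerator parameters can be shifted without a
  case distinction on the sign of the index.
\<close>

definition hyp_coeff :: "real \<Rightarrow> real \<Rightarrow> real \<Rightarrow> real \<Rightarrow> nat \<Rightarrow> real" where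
  "hyp_coeff s a c m k =
     pochhammer (- m) k * pochhammer (m - 1 + s) k / (pochhammer a k * pochhammer c k)"

text \<open>
  The summation bound may exceed the degree, because \<open>(-n)\<^sub>k = 0\<close> for \<open>k > n\<close>. This gives all
  polynomials in the recurrence a common range of summation.
\<close>

lemma hypP_eq_sum_hyp_coeff:
  assumes "n \<le> N"
  shows "hypP a b c (int n) x = (\<Sum>k\<le>N. hyp_coeff (a + b) a c (real n) k * x ^ k)"
proof -
  have "hypP a b c (int n) x = (\<Sum>k\<le>n. hyp_coeff (a + b) a c (real n) k * x ^ k)"
    by (simp add: hypP_def hyp_coeff_def pochhammer_fact[symmetric] atMost_atLeast0 add.assoc mult_ac)
  also have "\<dots> = (\<Sum>k\<le>N. hyp_coeff (a + b) a c (real n) k * x ^ k)"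
    using assms
    by (intro sum.mono_neutral_left) (auto simp: hyp_coeff_def pochhammer_of_nat_eq_0_iff)
  finally show ?thesis .
qed

lemma pochhammer_shift:
  fixes z :: real
  shows "z * pochhammer (z + 1) k = pochhammer z k * (z + real k)"
  by (metis pochhammer_rec pochhammer_Suc)

text \<open>
  The common factor \<open>K\<close> is built from \<open>d - n = n - 2 + s\<close> and not from the parameter \<open>d - n - 1\<close>
  of the lowest polynomial, because shifting the latter upwards would divide by \<open>d - n - 1\<close>, which
  is zero for \<open>n = 2\<close>, \<open>s = 1\<close>.
\<close>

lemma shifted_hyp_coeffs:
  fixes a c s n d y :: real
  assumes d: "d = 2 * n + s - 2" and y: "y = real j - n"
    and n: "n \<noteq> 0" "n \<noteq> 1" and dn: "d - n \<noteq> 0" "d - n + 1 \<noteq> 0"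
    and ac: "a > 0" "c > 0"
  defines "K \<equiv> pochhammer (- n) j * pochhammer (d - n) j
                  / (pochhammer a (Suc j) * pochhammer c (Suc j))"
  shows "hyp_coeff s a c (n - 2) (Suc j) = K * (d - n - 1) * y * (y + 1) * (y + 2) / (n * (n - 1))"
      (is ?lower2)
    and "hyp_coeff s a c (n - 1) (Suc j) = - (K * (y + d) * y * (y + 1) / n)" (is ?lower1)
    and "hyp_coeff s a c n (Suc j) = K * y * (y + d) * (y + d + 1) / (d - n)" (is ?middle)
    and "hyp_coeff s a c (n + 1) (Suc j) =
           - (K * (n + 1) * (y + d) * (y + d + 1) * (y + d + 2) / ((d - n) * (d - n + 1)))"
      (is ?upper)
    and "hyp_coeff s a c (n - 1) j = - (K * (a + n + y) * (c + n + y) * y / n)" (is ?lower1')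
    and "hyp_coeff s a c n j = K * (a + n + y) * (c + n + y) * (y + d) / (d - n)" (is ?middle')
proof -
  define U V where "U = pochhammer (- n) j" and "V = pochhammer (d - n) j"
  have K: "K = U * V / (pochhammer a (Suc j) * pochhammer c (Suc j))"
    by (simp add: K_def U_def V_def)
  have j: "real j = y + n"
    using y by simp
  have U1: "pochhammer (1 - n) j = - (U * y / n)"
    using pochhammer_shift[of "- n" j] n by (simp add: U_def y field_simps)
  have U2: "pochhammer (2 - n) j = U * y * (y + 1) / (n * (n - 1))"
    using pochhammer_shift[of "1 - n" j] n unfolding U1 j by (simp add: field_simps)
  have V1: "pochhammer (d - n + 1) j = V * (y + d) / (d - n)"
    using pochhammer_shift[of "d - n" j] dn by (simp add: V_def y field_simps)
  have V2: "pochhammer (d - n + 2) j = V * (y + d) * (y + d + 1) / ((d - n) * (d - n + 1))"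
  proof -
    have "(d - n + 1) * pochhammer (d - n + 2) j = V * (y + d) / (d - n) * (y + d + 1)"
      using pochhammer_shift[of "d - n + 1" j] unfolding V1 j by (simp add: algebra_simps)
    then show ?thesis
      using dn by (simp add: nonzero_eq_divide_eq mult_ac)
  qed
  have den: "pochhammer a j = pochhammer a (Suc j) / (a + n + y)"
    "pochhammer c j = pochhammer c (Suc j) / (c + n + y)"
    "a + n + y > 0" "c + n + y > 0"
    using ac by (simp_all add: y pochhammer_Suc)
  have numer: "n - 2 - 1 + s = d - n - 1" "n - 1 - 1 + s = d - n" "n - 1 + s = d - n + 1"
    "n + 1 - 1 + s = d - n + 2" "- (n - 2) = 2 - n" "- (n - 1) = 1 - n" "- (n + 1) = - n - 1"
    using d by auto
  have UV_Suc: "pochhammer (2 - n) (Suc j) = U * y * (y + 1) / (n * (n - 1)) * (y + 2)"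
    "pochhammer (1 - n) (Suc j) = - (U * y / n) * (y + 1)"
    "pochhammer (- n) (Suc j) = U * y"
    "pochhammer (- n - 1) (Suc j) = - ((n + 1) * U)"
    "pochhammer (d - n - 1) (Suc j) = (d - n - 1) * V"
    "pochhammer (d - n) (Suc j) = V * (y + d)"
    "pochhammer (d - n + 1) (Suc j) = V * (y + d) / (d - n) * (y + d + 1)"
    "pochhammer (d - n + 2) (Suc j) =
       V * (y + d) * (y + d + 1) / ((d - n) * (d - n + 1)) * (y + d + 2)"
    unfolding U1[symmetric] U2[symmetric] V1[symmetric] V2[symmetric]
    using pochhammer_rec[of "- n - 1" j] pochhammer_rec[of "d - n - 1" j]
    by (simp_all add: pochhammer_Suc j U_def V_def algebra_simps)
  show ?lower2 ?lower1 ?middle ?upper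
    unfolding hyp_coeff_def numer UV_Suc K by (simp_all add: mult_ac)
  show ?lower1' ?middle'
    unfolding hyp_coeff_def numer U1 V1 U_def[symmetric] V_def[symmetric] K den(1,2)
    by (simp_all add: mult_ac)
qed

lemma hyp_coeff_recurrence:
  fixes a b c :: real
  assumes pos: "a > 0" "b > 0" "c > 0" and m: "2 \<le> m" and s: "s = a + b"
  shows "phi1 a b c m * hyp_coeff s a c (real m - 2) (Suc j)
       + phi2 a b c m * hyp_coeff s a c (real m - 1) (Suc j)
       + phi3 a b c m * hyp_coeff s a c (real m) (Suc j)
       + phi4 a b c m * hyp_coeff s a c (real m + 1) (Suc j)
       + phi5 a b c m * hyp_coeff s a c (real m - 1) j
       + phi6 a b c m * hyp_coeff s a c (real m) j = 0" (is "?L = 0")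
proof -
  define n d y where "n = real m" and "d = 2 * n + s - 2" and "y = real j - n"
  have n2: "n \<ge> 2"
    using m by (simp add: n_def)
  have nz: "n \<noteq> 0" "n \<noteq> 1" "d - n \<noteq> 0" "d - n + 1 \<noteq> 0" "d \<noteq> 1" "d \<noteq> 2" "n - 1 \<noteq> 0"
    using n2 pos s by (auto simp: d_def)
  define K where "K = pochhammer (- n) j * pochhammer (d - n) j
                        / (pochhammer a (Suc j) * pochhammer c (Suc j))"
  note coeffs = shifted_hyp_coeffs[OF d_def y_def nz(1-4) pos(1,3), folded K_def]
  have d: "d = 2 * n + a + b - 2"
    by (simp add: d_def s)
  note phis = phi_closed_forms[OF pos(1,2) m n_def d refl refl, of c]
  define f1 where "f1 = (d + 1) * (d + 2) * (d - (a + n)) * (d - (c + n)) / ((d - 1) * (d - 2))"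
  define f2 where "f2 = (d - n) * (d + 1 - (a + n)) * (d + 1 - (c + n))
    - (d + 1) * (d - n - 1) * (d - (a + n)) * (d - (c + n)) / (d - 2)"
  define f3 where "f3 = n * (d + 2) * (a + n - 1) * (c + n - 1) / (d - 1)
    - (n + 1) * (a + n) * (c + n)"
  have "?L = K * (- f1 * (d - n - 1) * y * (y + 1) * (y + 2)
         - (d + 2) * f2 * (y + d) * y * (y + 1)
         + (d + 1) * f3 * y * (y + d) * (y + d + 1)
         - (n + 1) * (a + n) * (c + n) * (y + d) * (y + d + 1) * (y + d + 2)
         + (d + 1) * (d + 2) * (a + n + y) * (c + n + y) * ((d - n - 1) * y + (n + 1) * (y + d)))"
    unfolding n_def[symmetric] phis coeffs f1_def[symmetric] f2_def[symmetric] f3_def[symmetric]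
    using nz by (simp add: divide_simps) algebra
  also have "\<dots> = 0"
    using cubic_identity[OF nz(5,6), of "a + n" "c + n" n y]
    by (simp add: f1_def f2_def f3_def)
  finally show ?thesis .
qed

section \<open>The recurrence\<close>

lemma hypP_recurrence_0:
  fixes a b c x :: real
  assumes "a > 0" "c > 0"
  shows "phi3 a b c 0 * hypP a b c 0 x + phi4 a b c 0 * hypP a b c 1 x
       + phi6 a b c 0 * x * hypP a b c 0 x = 0"
  using assms by (simp add: phi3_def phi4_def phi6_def hypP_def) (simp add: field_simps)

lemma hypP_recurrence_1:
  fixes a b c x :: real
  assumes "a > 0" "c > 0"
  shows "phi1 a b c 1 = 0"
    and "phi2 a b c 1 * hypP a b c 0 x + phi3 a b c 1 * hypP a b c 1 x
       + phi4 a b c 1 * hypP a b c 2 x + phi5 a b c 1 * x * hypP a b c 0 x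
       + phi6 a b c 1 * x * hypP a b c 1 x = 0"
proof -
  show "phi1 a b c 1 = 0"
    unfolding phi1_def phi2_def phi3_def phi4_def by (simp add: algebra_simps)
  have nz: "a \<noteq> 0" "c \<noteq> 0" "a + 1 \<noteq> 0" "c + 1 \<noteq> 0"
    using assms by auto
  have P0: "hypP a b c 0 x = 1"
    by (simp add: hypP_def)
  have P1: "hypP a b c 1 x = 1 - (a + b) * x / (a * c)"
    using nz by (simp add: hypP_def) (simp add: field_simps)
  have P2: "hypP a b c 2 x = 1 - 2 * (a + b + 1) * x / (a * c)
      + 2 * (a + b + 1) * (a + b + 2) * x ^ 2 / (a * (a + 1) * c * (c + 1))"
    using nz
    by (simp add: hypP_def numeral_2_eq_2 pochhammer_Suc) (simp add: divide_simps, algebra)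
  show "phi2 a b c 1 * hypP a b c 0 x + phi3 a b c 1 * hypP a b c 1 x
       + phi4 a b c 1 * hypP a b c 2 x + phi5 a b c 1 * x * hypP a b c 0 x
       + phi6 a b c 1 * x * hypP a b c 1 x = 0"
    unfolding P0 P1 P2 using nz
    by (simp add: phi2_def phi3_def phi4_def phi5_def phi6_def divide_simps) algebra
qed

theorem theorem5:
  fixes a b c x :: real and n :: nat
  assumes "a > 0" and "b > 0" and "c > 0"
  shows "phi1 a b c n * hypP a b c (int n - 2) x
       + phi2 a b c n * hypP a b c (int n - 1) x
       + phi3 a b c n * hypP a b c (int n) x
       + phi4 a b c n * hypP a b c (int n + 1) x
       + phi5 a b c n * x * hypP a b c (int n - 1) x
       + phi6 a b c n * x * hypP a b c (int n) x = 0"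
proof -
  consider "n = 0" | "n = 1" | "2 \<le> n"
    by linarith
  then show ?thesis
  proof cases
    case 1
    have "hypP a b c (-1) x = 0" "hypP a b c (-2) x = 0"
      by (simp_all add: hypP_def)
    then show ?thesis
      using hypP_recurrence_0[OF assms(1,3), of b x] 1 by simp
  next
    case 2
    then show ?thesis
      using hypP_recurrence_1[OF assms(1,3), of b] by simp
  next
    case 3
    define t where "t = hyp_coeff (a + b) a c"
    have poly: "hypP a b c (int k) x = (\<Sum>i\<le>N. t (real k) i * x ^ i)" if "k \<le> N" for k N
      using hypP_eq_sum_hyp_coeff[OF that] by (simp add: t_def)
    have P: "hypP a b c (int n - 2) x = (\<Sum>i\<le>Suc n. t (real n - 2) i * x ^ i)"
      "hypP a b c (int n - 1) x = (\<Sum>i\<le>Suc n. t (real n - 1) i * x ^ i)"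
      "hypP a b c (int n) x = (\<Sum>i\<le>Suc n. t (real n) i * x ^ i)"
      "hypP a b c (int n + 1) x = (\<Sum>i\<le>Suc n. t (real n + 1) i * x ^ i)"
      using poly[of "n - 2" "Suc n"] poly[of "n - 1" "Suc n"] poly[of n "Suc n"]
        poly[of "n + 1" "Suc n"] 3
      by (simp_all add: of_nat_diff add.commute)
    have P': "hypP a b c (int n - 1) x = (\<Sum>i\<le>n. t (real n - 1) i * x ^ i)"
      "hypP a b c (int n) x = (\<Sum>i\<le>n. t (real n) i * x ^ i)"
      using poly[of "n - 1" n] poly[of n n] 3 by (simp_all add: of_nat_diff)
    define F where "F i = phi1 a b c n * t (real n - 2) i + phi2 a b c n * t (real n - 1) i
        + phi3 a b c n * t (real n) i + phi4 a b c n * t (real n + 1) i" for i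
    define G where "G i = phi5 a b c n * t (real n - 1) i + phi6 a b c n * t (real n) i" for i
    have F0: "F 0 = 0"
      by (simp add: F_def t_def hyp_coeff_def phi1_def)
    have FG: "F (Suc i) + G i = 0" for i
      using hyp_coeff_recurrence[OF assms 3 refl, of i] by (simp add: F_def G_def t_def)
    have F: "phi1 a b c n * hypP a b c (int n - 2) x + phi2 a b c n * hypP a b c (int n - 1) x
        + phi3 a b c n * hypP a b c (int n) x + phi4 a b c n * hypP a b c (int n + 1) x
        = (\<Sum>i\<le>Suc n. F i * x ^ i)"
      unfolding P F_def by (simp only: sum_distrib_left sum.distrib distrib_right mult.assoc)
    have G: "phi5 a b c n * x * hypP a b c (int n - 1) x + phi6 a b c n * x * hypP a b c (int n) x
        = (\<Sum>i\<le>n. G i * x ^ Suc i)"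
      unfolding P' G_def by (simp add: sum_distrib_left sum.distrib algebra_simps)
    have "(\<Sum>i\<le>Suc n. F i * x ^ i) + (\<Sum>i\<le>n. G i * x ^ Suc i)
        = (\<Sum>i\<le>n. (F (Suc i) + G i) * x ^ Suc i)"
      by (simp only: sum.atMost_Suc_shift F0 mult_zero_left add_0 sum.distrib distrib_right)
    also have "\<dots> = 0"
      by (simp add: FG)
    finally show ?thesis
      using F G by simp
  qed
qed

end
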